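(* Let $K=\mathbb{F}_q$ be a finite field and let $S=K[x_1,\dots,x_m]$ be the polynomial ring with the standard grading. Let $\mathbb{X}\subset\mathbb{P}^{m-1}$ be a finite set of points such that the degrees of the elements of a minimal generating set of $I(\mathbb{X})$ (consisting of homogeneous polynomials) are all lower than $q+1$. Then, for a homogeneous ideal $I\subset S$, one has $I+I(\mathbb{P}^{m-1})=I(\mathbb{X})$ if and only if $I=I(\mathbb{X})$.
   Context: $\mathbb{P}^{m-1}$ denotes the finite set of $\mathbb{F}_q$-rational points of projective $(m-1)$-space over $K=\mathbb{F}_q$. For a subset $\mathbb{X}\subset\mathbb{P}^{m-1}$, the vanishing ideal $I(\mathbb{X})\subset S$ is the homogeneous ideal generated by the homogeneous polynomials of $S$ that vanish at every point of $\mathbb{X}$. In particular $I(\mathbb{P}^{m-1})$ is the vanishing ideal of the set of all rational points, and it is known that $I(\mathbb{P}^{m-1})=\langle x_i^qx_j-x_ix_j^q : 1\leq i<j\leq m\rangle$. *)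

theory Defs
  imports
    "HOL-Analysis.Finite_Cartesian_Product"
    "HOL-Library.Poly_Mapping"
    "HOL-Library.Set_Algebras"
begin

text \<open>
  The polynomial ring \<open>K[x\<^sub>i : i \<in> 'n]\<close> in \<open>m = CARD('n)\<close> variables: finitely supported
  maps from exponent vectors to coefficients. A finite field \<open>K\<close> with \<open>q\<close> elements is a
  type \<open>'k :: {field, finite}\<close> with \<open>q = CARD('k)\<close>.
\<close>

type_synonym ('n, 'k) mpoly = "('n \<Rightarrow>\<^sub>0 nat) \<Rightarrow>\<^sub>0 'k"

definition monom_degree :: "('n::finite \<Rightarrow>\<^sub>0 nat) \<Rightarrow> nat" where
  "monom_degree t = (\<Sum>i\<in>UNIV. Poly_Mapping.lookup t i)"

text \<open>The inserted \<open>0\<close> only matters for the zero polynomial, which gets degree \<open>0\<close>.\<close>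

definition total_degree :: "('n::finite, 'k::zero) mpoly \<Rightarrow> nat" where
  "total_degree p = Max (insert 0 (monom_degree ` Poly_Mapping.keys p))"

text \<open>As usual, the zero polynomial counts as homogeneous (of every degree).\<close>

definition homogeneous :: "('n::finite, 'k::zero) mpoly \<Rightarrow> bool" where
  "homogeneous p \<longleftrightarrow> (\<exists>d. \<forall>t\<in>Poly_Mapping.keys p. monom_degree t = d)"

definition mpoly_eval :: "'k::comm_semiring_1 ^ 'n \<Rightarrow> ('n::finite, 'k) mpoly \<Rightarrow> 'k" where
  "mpoly_eval v p =
     (\<Sum>t\<in>Poly_Mapping.keys p.
        Poly_Mapping.lookup p t * (\<Prod>i\<in>UNIV. (v $ i) ^ Poly_Mapping.lookup t i))"

text \<open>The ideals of a commutative ring are its submodules as a module over itself.\<close>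

global_interpretation ideal: module "times :: 'r::comm_ring_1 \<Rightarrow> 'r \<Rightarrow> 'r"
  by unfold_locales (auto simp: algebra_simps)

abbreviation is_ideal :: "'r::comm_ring_1 set \<Rightarrow> bool" where
  "is_ideal \<equiv> module.subspace (*)"

abbreviation ideal_generated :: "'r::comm_ring_1 set \<Rightarrow> 'r set" where
  "ideal_generated \<equiv> module.span (*)"

definition homogeneous_ideal :: "('n::finite, 'k::comm_ring_1) mpoly set \<Rightarrow> bool" where
  "homogeneous_ideal I \<longleftrightarrow>
     is_ideal I \<and> (\<exists>B. (\<forall>p\<in>B. homogeneous p) \<and> I = ideal_generated B)"

text \<open>Minimality is with respect to inclusion: no proper subset generates the ideal.\<close>

definition minimal_homogeneous_generating_set ::
    "('n::finite, 'k::comm_ring_1) mpoly set \<Rightarrow> ('n, 'k) mpoly set \<Rightarrow> bool" where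
  "minimal_homogeneous_generating_set G I \<longleftrightarrow>
     (\<forall>g\<in>G. homogeneous g) \<and> ideal_generated G = I \<and>
     (\<forall>H. H \<subset> G \<longrightarrow> ideal_generated H \<noteq> I)"

definition proportional :: "('k::field ^ 'n) rel" where
  "proportional = {(v, w). v \<noteq> 0 \<and> w \<noteq> 0 \<and> (\<exists>c. c \<noteq> 0 \<and> w = c *s v)}"

text \<open>
  The points of projective \<open>(m - 1)\<close>-space over \<open>K\<close>, each being the set of all its
  homogeneous coordinate vectors.
\<close>

definition projective_space :: "('k::field ^ 'n) set set" where
  "projective_space = (UNIV - {0}) // proportional"

text \<open>
  For a homogeneous polynomial, vanishing does not depend on the chosen coordinate
  vector; see the lemma \<open>vanishes_at_iff\<close> below.
\<close>

definition vanishes_at :: "('n::finite, 'k::field) mpoly \<Rightarrow> ('k ^ 'n) set \<Rightarrow> bool" where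
  "vanishes_at p P \<longleftrightarrow> (\<forall>v\<in>P. mpoly_eval v p = 0)"

definition vanishing_ideal :: "('k::field ^ 'n::finite) set set \<Rightarrow> ('n, 'k) mpoly set" where
  "vanishing_ideal X = ideal_generated {p. homogeneous p \<and> (\<forall>P\<in>X. vanishes_at p P)}"

lemma equiv_proportional: "equiv (UNIV - {0}) (proportional :: ('k::field ^ 'n) rel)"
proof (rule equivI)
  show "(proportional :: ('k ^ 'n) rel) \<subseteq> (UNIV - {0}) \<times> (UNIV - {0})"
    by (auto simp: proportional_def)
  show "refl_on (UNIV - {0}) (proportional :: ('k ^ 'n) rel)"
    by (rule refl_onI) (auto simp: proportional_def intro: exI[of _ 1])
  show "sym (proportional :: ('k ^ 'n) rel)"
  proof (rule symI)
    fix v w :: "'k ^ 'n"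
    assume "(v, w) \<in> proportional"
    then obtain c where c: "v \<noteq> 0" "w \<noteq> 0" "c \<noteq> 0" "w = c *s v"
      by (auto simp: proportional_def)
    then have "v = inverse c *s w"
      by (simp add: vec_eq_iff field_simps)
    moreover have "inverse c \<noteq> 0"
      using c by simp
    ultimately show "(w, v) \<in> proportional"
      using c(1,2) unfolding proportional_def by blast
  qed
  show "trans (proportional :: ('k ^ 'n) rel)"
  proof (rule transI)
    fix u v w :: "'k ^ 'n"
    assume "(u, v) \<in> proportional" "(v, w) \<in> proportional"
    then obtain c d where "u \<noteq> 0" "w \<noteq> 0" "c \<noteq> 0" "d \<noteq> 0" "v = c *s u" "w = d *s v"
      by (auto simp: proportional_def)
    then have "w = (d * c) *s u" "d * c \<noteq> 0"
      by (simp_all add: vec_eq_iff)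
    with \<open>u \<noteq> 0\<close> \<open>w \<noteq> 0\<close> show "(u, w) \<in> proportional"
      unfolding proportional_def by blast
  qed
qed

lemma mpoly_eval_scale:
  fixes v :: "'k::field ^ 'n::finite"
  assumes "\<forall>t\<in>Poly_Mapping.keys p. monom_degree t = d"
  shows "mpoly_eval (c *s v) p = c ^ d * mpoly_eval v p"
proof -
  have "Poly_Mapping.lookup p t * (\<Prod>i\<in>UNIV. ((c *s v) $ i) ^ Poly_Mapping.lookup t i) =
        c ^ d * (Poly_Mapping.lookup p t * (\<Prod>i\<in>UNIV. (v $ i) ^ Poly_Mapping.lookup t i))" if "t \<in> Poly_Mapping.keys p" for t
  proof -
    have "(\<Prod>i\<in>(UNIV :: 'n set). c ^ Poly_Mapping.lookup t i) = c ^ d"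
      using assms that by (auto simp: monom_degree_def simp flip: power_sum)
    then show ?thesis
      by (simp add: power_mult_distrib prod.distrib)
  qed
  then show ?thesis
    unfolding mpoly_eval_def sum_distrib_left by (rule sum.cong[OF refl])
qed

lemma vanishes_at_iff:
  assumes "homogeneous p" "P \<in> projective_space" "v \<in> P"
  shows "vanishes_at p P \<longleftrightarrow> mpoly_eval v p = 0"
proof
  assume "vanishes_at p P"
  then show "mpoly_eval v p = 0"
    using assms(3) by (simp add: vanishes_at_def)
next
  assume v: "mpoly_eval v p = 0"
  obtain d where d: "\<forall>t\<in>Poly_Mapping.keys p. monom_degree t = d"
    using assms(1) by (auto simp: homogeneous_def)
  have "mpoly_eval w p = 0" if "w \<in> P" for w
  proof -
    have "(v, w) \<in> proportional"
      using assms that quotient_eq_iff[OF equiv_proportional]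
      unfolding projective_space_def by blast
    then obtain c where "w = c *s v"
      by (auto simp: proportional_def)
    then show ?thesis
      using v by (simp add: mpoly_eval_scale[OF d])
  qed
  then show "vanishes_at p P"
    by (simp add: vanishes_at_def)
qed

end

theory Submission
  imports Defs "HOL-Computational_Algebra.Polynomial"
begin

text \<open>
  A homogeneous polynomial of degree at most \<open>q\<close> vanishing at every rational point is \<open>0\<close>:
  its value at the unit vectors excludes the monomials \<open>x\<^sub>i^q\<close>, so it is reduced, and a reduced
  polynomial is determined by its values on \<open>K\<^sup>m\<close>. Hence \<open>I(P\<^sup>m\<^sup>-\<^sup>1)\<close> lives in degrees
  greater than \<open>q\<close>. If \<open>I + I(P\<^sup>m\<^sup>-\<^sup>1) = I(X)\<close>, then comparing the homogeneous components of
  degree \<open>deg g \<le> q\<close> in \<open>g = a + b\<close> shows that every generator \<open>g\<close> of \<open>I(X)\<close> lies in \<open>I\<close>.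
\<close>

section \<open>Reduced polynomials are determined by their values\<close>

lemma univariate_coeffs_zero:
  fixes b :: "nat \<Rightarrow> 'k::{field,finite}"
  assumes "\<And>x. (\<Sum>k<CARD('k). b k * x ^ k) = 0" and "k < CARD('k)"
  shows "b k = 0"
proof -
  define p where "p = (\<Sum>k<CARD('k). Polynomial.monom (b k) k)"
  have coeff: "coeff p j = (if j < CARD('k) then b j else 0)" for j
    by (simp add: p_def coeff_sum coeff_monom sum.delta)
  have "p = 0"
  proof (rule ccontr)
    assume "p \<noteq> 0"
    have "poly p x = 0" for x
      using assms(1) by (simp add: p_def poly_sum poly_monom)
    \<comment> \<open>All q field elements are roots of \<open>p\<close>, but a nonzero polynomial
      has at most \<open>degree p\<close> roots. By \<open>coeff\<close>, the coefficients of
      \<open>p\<close> vanish from index q on, hence so does the leading one.\<close>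
    then have "CARD('k) \<le> degree p"
      using card_poly_roots_bound[OF \<open>p \<noteq> 0\<close>] by simp
    then have "lead_coeff p = 0"
      by (simp add: coeff)
    with \<open>p \<noteq> 0\<close> show False
      by simp
  qed
  with coeff[of k] assms(2) show ?thesis
    by simp
qed

text \<open>Induction on the number of variables, splitting off one variable \<open>a\<close> and
  reading the sum as a univariate polynomial in it. The condition that \<open>A\<close> separates
  the exponents in \<open>T\<close> replaces zero exponents outside \<open>A\<close>; it passes to
  the fibres of constant \<open>a\<close>-exponent.\<close>

lemma reduced_coeffs_zero:
  fixes c :: "('n \<Rightarrow> nat) \<Rightarrow> 'k::{field,finite}"
  assumes "finite A" "finite T" "\<And>t i. t \<in> T \<Longrightarrow> i \<in> A \<Longrightarrow> t i < CARD('k)"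
    and "\<And>t u. t \<in> T \<Longrightarrow> u \<in> T \<Longrightarrow> (\<And>i. i \<in> A \<Longrightarrow> t i = u i) \<Longrightarrow> t = u"
    and "\<And>v. (\<Sum>t\<in>T. c t * (\<Prod>i\<in>A. v i ^ t i)) = 0"
    and "t \<in> T"
  shows "c t = 0"
  using assms
proof (induction A arbitrary: T t rule: finite_induct)
  case empty
  \<comment> \<open>Without variables any two exponents in \<open>T\<close> agree vacuously on
    \<open>A\<close>, so the vanishing sum is \<open>c t\<close> itself.\<close>
  then have "T = {t}"
    by blast
  with empty(4)[of undefined] show ?case
    by simp
next
  case (insert a A)
  define T' where "T' k = {s \<in> T. s a = k}" for k
  have zero: "(\<Sum>s\<in>T' k. c s * (\<Prod>i\<in>A. v i ^ s i)) = 0" if "k < CARD('k)" for k v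
  proof (rule univariate_coeffs_zero[OF _ that])
    fix x :: 'k
    have "(\<Sum>k<CARD('k). (\<Sum>s\<in>T' k. c s * (\<Prod>i\<in>A. v i ^ s i)) * x ^ k)
        = (\<Sum>k<CARD('k). \<Sum>s\<in>T' k. c s * (\<Prod>i\<in>insert a A. (v(a := x)) i ^ s i))"
    proof (intro sum.cong refl)
      fix k
      \<comment> \<open>Substituting \<open>x\<close> for the variable \<open>a\<close> does not
        affect the remaining factors, since \<open>a\<close> is not in \<open>A\<close>.\<close>
      have split: "(\<Prod>i\<in>insert a A. (v(a := x)) i ^ s i) = x ^ s a * (\<Prod>i\<in>A. v i ^ s i)" for s
      proof -
        have "(\<Prod>i\<in>A. (v(a := x)) i ^ s i) = (\<Prod>i\<in>A. v i ^ s i)"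
          using insert.hyps(2) by (intro prod.cong) auto
        then show ?thesis
          by (subst prod.insert[OF insert.hyps(1,2)]) simp
      qed
      then show "(\<Sum>s\<in>T' k. c s * (\<Prod>i\<in>A. v i ^ s i)) * x ^ k
        = (\<Sum>s\<in>T' k. c s * (\<Prod>i\<in>insert a A. (v(a := x)) i ^ s i))"
        unfolding sum_distrib_right split by (intro sum.cong refl) (simp add: T'_def)
    qed
    \<comment> \<open>The fibres \<open>T' k\<close> with k < q cover \<open>T\<close>, because
      every \<open>a\<close>-exponent is below q.\<close>
    also have "\<dots> = (\<Sum>s\<in>T. c s * (\<Prod>i\<in>insert a A. (v(a := x)) i ^ s i))"
      unfolding T'_def using insert.prems(1,2) by (intro sum.group) auto
    finally show "(\<Sum>k<CARD('k). (\<Sum>s\<in>T' k. c s * (\<Prod>i\<in>A. v i ^ s i)) * x ^ k) = 0"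
      using insert.prems(4) by simp
  qed
  show ?case
  proof (rule insert.IH[of "T' (t a)"])
    show "finite (T' (t a))" "t \<in> T' (t a)"
      using insert.prems by (auto simp: T'_def)
    show "s i < CARD('k)" if "s \<in> T' (t a)" "i \<in> A" for s i
      using that insert.prems(2) by (auto simp: T'_def)
    show "s = u" if "s \<in> T' (t a)" "u \<in> T' (t a)" "\<And>i. i \<in> A \<Longrightarrow> s i = u i" for s u
    proof (rule insert.prems(3))
      show "s i = u i" if "i \<in> insert a A" for i
        using that \<open>s \<in> T' (t a)\<close> \<open>u \<in> T' (t a)\<close> \<open>\<And>i. i \<in> A \<Longrightarrow> s i = u i\<close>
        by (auto simp: T'_def)
    qed (use that in \<open>simp_all add: T'_def\<close>)
    show "(\<Sum>s\<in>T' (t a). c s * (\<Prod>i\<in>A. v i ^ s i)) = 0" for v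
      using zero insert.prems(2,5) by simp
  qed
qed

lemma reduced_mpoly_zero:
  fixes p :: "('n::finite, 'k::{field,finite}) mpoly"
  assumes "\<And>t i. t \<in> Poly_Mapping.keys p \<Longrightarrow> Poly_Mapping.lookup t i < CARD('k)"
    and "\<And>v. mpoly_eval v p = 0"
  shows "p = 0"
proof -
  let ?T = "Poly_Mapping.lookup ` Poly_Mapping.keys p"
  \<comment> \<open>On \<open>?T\<close> the map \<open>Abs_poly_mapping\<close> inverts
    \<open>lookup\<close>, so \<open>?c\<close> returns the coefficients of \<open>p\<close>; its
    values elsewhere do not enter the sum.\<close>
  let ?c = "\<lambda>f. Poly_Mapping.lookup p (Abs_poly_mapping f)"
  have inj: "inj_on Poly_Mapping.lookup (Poly_Mapping.keys p)"
    by (rule inj_onI) (simp add: lookup_inject)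
  have "Poly_Mapping.lookup p t = 0" if "t \<in> Poly_Mapping.keys p" for t
  proof -
    have "?c (Poly_Mapping.lookup t) = 0"
    proof (rule reduced_coeffs_zero[where A = UNIV and T = ?T and c = ?c])
      fix v :: "'n \<Rightarrow> 'k"
      show "(\<Sum>f\<in>?T. ?c f * (\<Prod>i\<in>UNIV. v i ^ f i)) = 0"
        using assms(2)[of "vec_lambda v"]
        by (simp add: sum.reindex[OF inj] mpoly_eval_def)
    qed (use assms(1) that in auto)
    then show ?thesis
      by simp
  qed
  then show ?thesis
    by (intro poly_mapping_eqI) (metis in_keys_iff lookup_zero)
qed

section \<open>The vanishing ideal of projective space starts above degree q\<close>

lemma mpoly_eval_axis:
  fixes p :: "('n::finite, 'k::field) mpoly"
  assumes "\<forall>t\<in>Poly_Mapping.keys p. monom_degree t = d"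
  shows "mpoly_eval (axis i 1) p = Poly_Mapping.lookup p (Poly_Mapping.single i d)"
proof -
  \<comment> \<open>A monomial survives at the unit vector only if it is a pure power of the i-th
    variable, and homogeneity fixes the exponent as \<open>d\<close>.\<close>
  have "(\<Prod>j\<in>UNIV. (axis i (1::'k) $ j) ^ Poly_Mapping.lookup t j)
      = (if t = Poly_Mapping.single i d then 1 else 0)" if t: "t \<in> Poly_Mapping.keys p" for t
  proof (cases "\<exists>j. j \<noteq> i \<and> Poly_Mapping.lookup t j \<noteq> 0")
    case True
    then obtain j where j: "j \<noteq> i" "Poly_Mapping.lookup t j \<noteq> 0"
      by blast
    then have "(\<Prod>j\<in>UNIV. (axis i (1::'k) $ j) ^ Poly_Mapping.lookup t j) = 0"
      by (intro prod_zero) (auto simp: axis_def intro!: bexI[of _ j])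
    with j show ?thesis
      by (auto simp: lookup_single)
  next
    case False
    then have "monom_degree t = (\<Sum>j\<in>UNIV. if j = i then Poly_Mapping.lookup t i else 0)"
      unfolding monom_degree_def by (intro sum.cong) auto
    then have "t = Poly_Mapping.single i d"
      using False assms t by (intro poly_mapping_eqI) (auto simp: lookup_single when_def)
    moreover have "(\<Prod>j\<in>UNIV. (axis i (1::'k) $ j) ^ Poly_Mapping.lookup t j) = 1"
      using False by (intro prod.neutral) (auto simp: axis_def)
    ultimately show ?thesis
      by simp
  qed
  then have "mpoly_eval (axis i 1) p
      = (\<Sum>t\<in>Poly_Mapping.keys p. if t = Poly_Mapping.single i d then Poly_Mapping.lookup p t else 0)"
    unfolding mpoly_eval_def by (intro sum.cong) auto
  then show ?thesis
    by (auto simp: in_keys_iff)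
qed

lemma vanishing_on_projective_space_low_degree:
  fixes p :: "('n::finite, 'k::{field,finite}) mpoly"
  assumes d: "\<forall>t\<in>Poly_Mapping.keys p. monom_degree t = d" and "d \<le> CARD('k)"
    and van: "\<forall>P\<in>projective_space. vanishes_at p P"
  shows "p = 0"
proof (rule reduced_mpoly_zero)
  have nz: "mpoly_eval v p = 0" if "v \<noteq> 0" for v :: "'k ^ 'n"
  proof -
    have "proportional `` {v} \<in> projective_space"
      using that by (auto simp: projective_space_def intro: quotientI)
    moreover have "v \<in> proportional `` {v}"
      using that equiv_class_self[OF equiv_proportional] by blast
    ultimately show ?thesis
      using van by (auto simp: vanishes_at_def)
  qed
  have axis_nz: "axis i (1::'k) \<noteq> 0" for i :: 'n
    by (auto simp: vec_eq_iff axis_def)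
  show "mpoly_eval v p = 0" for v
  proof (cases "v = 0")
    case True
    \<comment> \<open>The origin represents no projective point. As zero times a unit vector it gets
      the value \<open>0 ^ d\<close> times 0, which covers d = 0 as well, where \<open>0 ^ d\<close>
      is 1.\<close>
    then have v: "v = 0 *s axis undefined 1"
      by (simp add: vec_eq_iff)
    show ?thesis
      unfolding v mpoly_eval_scale[OF d] nz[OF axis_nz] by simp
  qed (rule nz)
  fix t i
  assume t: "t \<in> Poly_Mapping.keys p"
  show "Poly_Mapping.lookup t i < CARD('k)"
  proof (rule ccontr)
    assume "\<not> ?thesis"
    moreover have split: "monom_degree t
        = Poly_Mapping.lookup t i + (\<Sum>j\<in>UNIV - {i}. Poly_Mapping.lookup t j)"
      unfolding monom_degree_def by (rule sum.remove) auto
    moreover have "monom_degree t = d"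
      using d t by blast
    \<comment> \<open>An exponent of at least q inside a total degree of at most q leaves nothing
      for the other variables.\<close>
    ultimately have "Poly_Mapping.lookup t i = d" "(\<Sum>j\<in>UNIV - {i}. Poly_Mapping.lookup t j) = 0"
      using \<open>d \<le> CARD('k)\<close> by linarith+
    then have "t = Poly_Mapping.single i d"
      by (intro poly_mapping_eqI) (auto simp: lookup_single when_def)
    then have "Poly_Mapping.lookup p t = 0"
      using mpoly_eval_axis[OF d, of i] nz[OF axis_nz] by simp
    with t show False
      by (simp add: in_keys_iff)
  qed
qed

lemma monom_degree_add: "monom_degree (s + t) = monom_degree s + monom_degree t"
  by (simp add: monom_degree_def lookup_add sum.distrib)

text \<open>Multiplication never lowers the degrees of monomials. In this form, a degree bound on
  generators passes to the whole ideal through \<open>ideal.span_minimal\<close>.\<close>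

lemma ideal_high_degree:
  "is_ideal {p :: ('n::finite, 'k::comm_ring_1) mpoly. \<forall>t\<in>Poly_Mapping.keys p. n \<le> monom_degree t}"
proof (rule ideal.subspaceI)
  fix c p :: "('n, 'k) mpoly"
  assume "p \<in> {p. \<forall>t\<in>Poly_Mapping.keys p. n \<le> monom_degree t}"
  then show "c * p \<in> {p. \<forall>t\<in>Poly_Mapping.keys p. n \<le> monom_degree t}"
    using keys_mult[of c p] by (fastforce simp: monom_degree_add)
qed (use Poly_Mapping.keys_add in \<open>fastforce+\<close>)

lemma vanishing_ideal_projective_space_degree:
  fixes p :: "('n::finite, 'k::{field,finite}) mpoly"
  assumes "p \<in> vanishing_ideal projective_space" "t \<in> Poly_Mapping.keys p"
  shows "CARD('k) < monom_degree t"
proof -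
  have "vanishing_ideal projective_space
      \<subseteq> {p :: ('n, 'k) mpoly. \<forall>t\<in>Poly_Mapping.keys p. Suc CARD('k) \<le> monom_degree t}"
    unfolding vanishing_ideal_def
  proof (rule ideal.span_minimal[OF subsetI ideal_high_degree])
    fix p :: "('n, 'k) mpoly"
    assume "p \<in> {p. homogeneous p \<and> (\<forall>P\<in>projective_space. vanishes_at p P)}"
    then obtain d where d: "\<forall>t\<in>Poly_Mapping.keys p. monom_degree t = d"
      and "\<forall>P\<in>projective_space. vanishes_at p P"
      by (auto simp: homogeneous_def)
    then have "p = 0" if "d \<le> CARD('k)"
      using vanishing_on_projective_space_low_degree that by blast
    then show "p \<in> {p. \<forall>t\<in>Poly_Mapping.keys p. Suc CARD('k) \<le> monom_degree t}"
      using d by (cases "d \<le> CARD('k)") auto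
  qed
  from subsetD[OF this assms(1)] assms(2) show ?thesis
    by auto
qed

section \<open>Homogeneous components\<close>

lift_definition homogeneous_component ::
    "nat \<Rightarrow> ('n::finite, 'k::zero) mpoly \<Rightarrow> ('n, 'k) mpoly"
  is "\<lambda>d p t. if monom_degree t = d then p t else 0"
  by (rule finite_subset[rotated]) auto

lemma homogeneous_component_add:
  "homogeneous_component d (p + r) = homogeneous_component d p + homogeneous_component d r"
  by (rule poly_mapping_eqI) (simp add: homogeneous_component.rep_eq lookup_add)

lemma homogeneous_component_eq_0:
  assumes "\<And>t. t \<in> Poly_Mapping.keys p \<Longrightarrow> monom_degree t \<noteq> d"
  shows "homogeneous_component d p = 0"
  using assms by (intro poly_mapping_eqI) (auto simp: homogeneous_component.rep_eq in_keys_iff)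

lemma homogeneous_component_0 [simp]: "homogeneous_component d 0 = 0"
  by (rule homogeneous_component_eq_0) simp

lemma homogeneous_component_self:
  assumes "\<And>t. t \<in> Poly_Mapping.keys p \<Longrightarrow> monom_degree t = d"
  shows "homogeneous_component d p = p"
  using assms by (intro poly_mapping_eqI) (auto simp: homogeneous_component.rep_eq in_keys_iff)

lemma homogeneous_component_cases:
  assumes "homogeneous p"
  shows "homogeneous_component d p = p \<or> homogeneous_component d p = 0"
  using assms homogeneous_component_self[of p] homogeneous_component_eq_0[of p]
  unfolding homogeneous_def by metis

lemma homogeneous_single_mult:
  assumes "homogeneous p"
  shows "homogeneous (Poly_Mapping.single t c * p)"
proof -
  obtain e where e: "\<forall>s\<in>Poly_Mapping.keys p. monom_degree s = e"
    using assms by (auto simp: homogeneous_def)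
  have "monom_degree s = monom_degree t + e"
    if "s \<in> Poly_Mapping.keys (Poly_Mapping.single t c * p)" for s
    using that keys_mult[of "Poly_Mapping.single t c" p] e
    by (fastforce simp: monom_degree_add split: if_splits)
  then show ?thesis
    by (auto simp: homogeneous_def)
qed

text \<open>Taking components is additive, so \<open>r\<close> may be built up term by term. A
  single term times \<open>b\<close> is homogeneous, so its component is either the whole product or
  0.\<close>

lemma homogeneous_component_mult_mem:
  assumes "is_ideal I" "b \<in> I" "homogeneous b"
  shows "homogeneous_component d (r * b) \<in> I"
proof (induction r rule: update_induct)
  case const
  show ?case
    using ideal.subspace_0[OF assms(1)] by simp
next
  case (update r t c)
  \<comment> \<open>The induction updates only at a key not yet in \<open>r\<close>, which makes the
    update an addition.\<close>
  have split: "Poly_Mapping.update t c r = Poly_Mapping.single t c + r"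
    using update(1) by (intro poly_mapping_eqI)
      (auto simp: lookup_update lookup_add lookup_single in_keys_iff when_def)
  have "Poly_Mapping.single t c * b \<in> I"
    using assms by (simp add: ideal.subspace_scale)
  then have "homogeneous_component d (Poly_Mapping.single t c * b) \<in> I"
    using homogeneous_component_cases[OF homogeneous_single_mult[OF assms(3)], of d t c]
      ideal.subspace_0[OF assms(1)] by auto
  then show ?case
    using assms(1) update(3) unfolding split
    by (simp add: distrib_right homogeneous_component_add ideal.subspace_add)
qed

text \<open>Every element is a sum of multiples of homogeneous generators, and the component of each
  multiple stays in \<open>I\<close>.\<close>

lemma homogeneous_ideal_component:
  assumes "homogeneous_ideal I" "a \<in> I"
  shows "homogeneous_component d a \<in> I"
proof -
  obtain B where B: "\<forall>p\<in>B. homogeneous p" "I = ideal_generated B" and I: "is_ideal I"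
    using assms(1) by (auto simp: homogeneous_ideal_def)
  from assms(2) have "a \<in> ideal_generated B"
    using B by simp
  then show ?thesis
  proof (induction rule: ideal.span_induct_alt)
    case base
    show ?case
      using ideal.subspace_0[OF I] by simp
  next
    case (step c x y)
    have "homogeneous_component d (c * x) \<in> I"
      using B step by (intro homogeneous_component_mult_mem[OF I]) (auto intro: ideal.span_base)
    then show ?case
      using step I by (simp add: homogeneous_component_add ideal.subspace_add)
  qed
qed

section \<open>Comparing \<open>I\<close> with the vanishing ideal of \<open>X\<close>\<close>

lemma is_ideal_vanishing_ideal: "is_ideal (vanishing_ideal X)"
  unfolding vanishing_ideal_def by (rule ideal.subspace_span)

lemma vanishing_ideal_antimono:
  assumes "X \<subseteq> Y"
  shows "vanishing_ideal Y \<subseteq> vanishing_ideal X"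
  unfolding vanishing_ideal_def using assms by (intro ideal.span_mono) auto

lemma homogeneous_low_degree_mem:
  fixes g :: "('n::finite, 'k::{field,finite}) mpoly"
  assumes I: "homogeneous_ideal I" and "homogeneous g" "total_degree g \<le> CARD('k)"
    and g: "g \<in> I + vanishing_ideal projective_space"
  shows "g \<in> I"
proof (cases "g = 0")
  case True
  then show ?thesis
    using I by (auto simp: homogeneous_ideal_def ideal.subspace_0)
next
  case False
  obtain d where d: "\<forall>t\<in>Poly_Mapping.keys g. monom_degree t = d"
    using assms(2) by (auto simp: homogeneous_def)
  \<comment> \<open>This needs a monomial in \<open>g\<close>: for the zero polynomial
    \<open>d\<close> would be arbitrary.\<close>
  with False have "total_degree g = d"
    by (simp add: total_degree_def cong: image_cong)
  with assms(3) have "d \<le> CARD('k)"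
    by simp
  obtain a b where ab: "g = a + b" "a \<in> I" "b \<in> vanishing_ideal projective_space"
    using g by (rule set_plus_elim)
  have "homogeneous_component d b = 0"
    using vanishing_ideal_projective_space_degree[OF ab(3)] \<open>d \<le> CARD('k)\<close>
    by (intro homogeneous_component_eq_0) fastforce
  moreover have "homogeneous_component d g = g"
    using d by (intro homogeneous_component_self) auto
  ultimately have "g = homogeneous_component d a"
    using ab(1) by (simp add: homogeneous_component_add)
  then show ?thesis
    using homogeneous_ideal_component[OF I ab(2)] by metis
qed

theorem proposition2p15:
  fixes X :: "('k::{field,finite} ^ 'n::finite) set set"
    and G I :: "('n, 'k) mpoly set"
  assumes "X \<subseteq> projective_space" and "finite X"
    and "minimal_homogeneous_generating_set G (vanishing_ideal X)"
    and "\<forall>g\<in>G. total_degree g < CARD('k) + 1"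
    and "homogeneous_ideal I"
  shows "I + vanishing_ideal projective_space = vanishing_ideal X \<longleftrightarrow> I = vanishing_ideal X"
proof
  assume "I = vanishing_ideal X"
  \<comment> \<open>One inclusion holds because the second summand lies inside the first, the other
    by adding 0.\<close>
  moreover have "vanishing_ideal X + vanishing_ideal projective_space = vanishing_ideal X"
    using vanishing_ideal_antimono[OF assms(1)] is_ideal_vanishing_ideal[of X]
      is_ideal_vanishing_ideal[of projective_space]
    by (force simp: set_plus_def ideal.subspace_add subset_iff dest: ideal.subspace_0)
  ultimately show "I + vanishing_ideal projective_space = vanishing_ideal X"
    by simp
next
  assume eq: "I + vanishing_ideal projective_space = vanishing_ideal X"
  have G: "\<forall>g\<in>G. homogeneous g" "ideal_generated G = vanishing_ideal X"
    using assms(3) by (auto simp: minimal_homogeneous_generating_set_def)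
  show "I = vanishing_ideal X"
  proof
    show "I \<subseteq> vanishing_ideal X"
    proof
      fix a
      assume "a \<in> I"
      then have "a + 0 \<in> I + vanishing_ideal projective_space"
        by (intro set_plus_intro ideal.subspace_0 is_ideal_vanishing_ideal)
      then show "a \<in> vanishing_ideal X"
        by (simp add: eq)
    qed
    have "G \<subseteq> I"
    proof
      fix g
      assume "g \<in> G"
      then have "g \<in> I + vanishing_ideal projective_space"
        unfolding eq G(2)[symmetric] by (rule ideal.span_base)
      then show "g \<in> I"
        using \<open>g \<in> G\<close> G(1) assms(4) by (intro homogeneous_low_degree_mem[OF assms(5)]) auto
    qed
    then show "vanishing_ideal X \<subseteq> I"
      using assms(5) unfolding G(2)[symmetric] homogeneous_ideal_def
      by (intro ideal.span_minimal) auto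
  qed
qed

end
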